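(* Let $\mathcal{D}(A)=\bigcup_{i\ge0}\mathcal{D}(A)_i$ be the order filtration of the ring of differential operators $\mathcal{D}(A)$ on $A$. Then, for each $i\ge0$, $\mathcal{D}(A)_i$ is a finitely generated left $A$-module.
   Context: $K$ is a field of characteristic zero, $P_n=K[x_1,\ldots,x_n]$, $I$ is a prime but not maximal ideal of $P_n$, and $A=P_n/I$ (not assumed regular). The ring of ($K$-linear) differential operators on $A$ is $\mathcal{D}(A)=\bigcup_{i\ge0}\mathcal{D}(A)_i\subseteq\mathrm{End}_K(A)$, where $\mathcal{D}(A)_0=A$ (acting by multiplication) and, for $i\ge1$, $\mathcal{D}(A)_i=\{u\in\mathrm{End}_K(A): au-ua\in\mathcal{D}(A)_{i-1}\text{ for all }a\in A\}$. This filtration is called the order filtration. *)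

theory Defs
  imports "HOL-Library.Poly_Mapping" "HOL-Algebra.QuotRing" "HOL-Algebra.Module"
begin

text \<open>
  A monomial is a finitely supported exponent function, a polynomial is a finitely supported
  function from monomials to coefficients, and the multiplication on \<^typ>\<open>(nat \<Rightarrow>\<^sub>0 nat) \<Rightarrow>\<^sub>0 'k::comm_ring_1\<close>
  is the convolution product. The ring below is $K[x_1,\ldots,x_n]$.
\<close>

definition mpoly_ring :: "nat \<Rightarrow> ((nat \<Rightarrow>\<^sub>0 nat) \<Rightarrow>\<^sub>0 'k::field) ring" where
  "mpoly_ring n =
     \<lparr>carrier = {p. \<forall>m\<in>Poly_Mapping.keys p. Poly_Mapping.keys m \<subseteq> {1..n}},
      mult = (*), one = 1, zero = 0, add = (+)\<rparr>"

text \<open>The structure map of the $K$-algebra $P_n / I$.\<close>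

definition quot_scalar ::
  "nat \<Rightarrow> ((nat \<Rightarrow>\<^sub>0 nat) \<Rightarrow>\<^sub>0 'k::field) set \<Rightarrow> 'k \<Rightarrow> ((nat \<Rightarrow>\<^sub>0 nat) \<Rightarrow>\<^sub>0 'k) set" where
  "quot_scalar n I c = I +>\<^bsub>mpoly_ring n\<^esub> Poly_Mapping.single 0 c"

text \<open>
  In the following, a commutative \<open>K\<close>-algebra is a commutative ring \<open>A\<close> together with its
  structure map \<open>\<sigma> :: 'k \<Rightarrow> 'a\<close>. The \<open>K\<close>-linear endomorphisms of \<open>A\<close> are represented by
  functions that are extensional on \<open>carrier A\<close>, so that equality of endomorphisms is equality
  of functions; \<open>A\<close> acts on them from the left by $(a u)(x) = a\,u(x)$.
\<close>

definition K_endos :: "('k \<Rightarrow> 'a) \<Rightarrow> ('a, 'm) ring_scheme \<Rightarrow> ('a \<Rightarrow> 'a) set" where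
  "K_endos \<sigma> A =
     {u \<in> carrier A \<rightarrow>\<^sub>E carrier A.
        (\<forall>x\<in>carrier A. \<forall>y\<in>carrier A. u (x \<oplus>\<^bsub>A\<^esub> y) = u x \<oplus>\<^bsub>A\<^esub> u y) \<and>
        (\<forall>c. \<forall>x\<in>carrier A. u (\<sigma> c \<otimes>\<^bsub>A\<^esub> x) = \<sigma> c \<otimes>\<^bsub>A\<^esub> u x)}"

definition End_alg :: "('k \<Rightarrow> 'a) \<Rightarrow> ('a, 'm) ring_scheme \<Rightarrow> ('a, 'a \<Rightarrow> 'a) module" where
  "End_alg \<sigma> A =
     \<lparr>carrier = K_endos \<sigma> A,
      mult = compose (carrier A),
      one = (\<lambda>x\<in>carrier A. x),
      zero = (\<lambda>x\<in>carrier A. \<zero>\<^bsub>A\<^esub>),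
      add = (\<lambda>u v. \<lambda>x\<in>carrier A. u x \<oplus>\<^bsub>A\<^esub> v x),
      smult = (\<lambda>a u. \<lambda>x\<in>carrier A. a \<otimes>\<^bsub>A\<^esub> u x)\<rparr>"

definition mult_op :: "('a, 'm) ring_scheme \<Rightarrow> 'a \<Rightarrow> 'a \<Rightarrow> 'a" where
  "mult_op A a = (\<lambda>x\<in>carrier A. a \<otimes>\<^bsub>A\<^esub> x)"

primrec diff_ops_le :: "('k \<Rightarrow> 'a) \<Rightarrow> ('a, 'm) ring_scheme \<Rightarrow> nat \<Rightarrow> ('a \<Rightarrow> 'a) set" where
  "diff_ops_le \<sigma> A 0 = mult_op A ` carrier A"
| "diff_ops_le \<sigma> A (Suc i) =
     {u \<in> carrier (End_alg \<sigma> A). \<forall>a\<in>carrier A.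
        mult_op A a \<otimes>\<^bsub>End_alg \<sigma> A\<^esub> u \<ominus>\<^bsub>End_alg \<sigma> A\<^esub> u \<otimes>\<^bsub>End_alg \<sigma> A\<^esub> mult_op A a
          \<in> diff_ops_le \<sigma> A i}"

definition diff_ops :: "('k \<Rightarrow> 'a) \<Rightarrow> ('a, 'm) ring_scheme \<Rightarrow> ('a, 'a \<Rightarrow> 'a) module" where
  "diff_ops \<sigma> A = (End_alg \<sigma> A)\<lparr>carrier := (\<Union>i. diff_ops_le \<sigma> A i)\<rparr>"

definition fin_gen_module :: "('a, 'm) ring_scheme \<Rightarrow> ('a, 'b, 'c) module_scheme \<Rightarrow> bool" where
  "fin_gen_module R M \<longleftrightarrow>
     module R M \<and>
     (\<exists>S. finite S \<and> S \<subseteq> carrier M \<and>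
        (\<forall>u\<in>carrier M. \<exists>c\<in>S \<rightarrow> carrier R. u = (\<Oplus>\<^bsub>M\<^esub>s\<in>S. c s \<odot>\<^bsub>M\<^esub> s)))"

end

theory Submission
  imports Complex_Main "HOL-Algebra.Ring_Divisibility" Defs
begin

text \<open>
  A differential operator of order at most $i$ on an algebra generated by $x_1,\ldots,x_n$ is
  determined by its values at the monomials of degree at most $i$ in the $x_j$: if these vanish,
  then by induction on the order so do the commutators with the $x_j$, and an operator that
  commutes with the generators and kills $1$ is zero. Hence $\mathcal{D}(A)_i$ embeds
  $A$-linearly into a finite power of $A$, and it remains to see that $A$ is noetherian. For
  $P_n$ this follows from Dickson's lemma by comparing leading monomials.
\<close>

section \<open>Modules separated by finitely many linear forms\<close>

text \<open>The finite power of \<open>A\<close> is never constructed: a finite set of linear forms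
  with trivial common kernel takes its place, and finite generation is proved by induction on that
  set, one ideal of values at a time. The degree bound equals the order bound because a commutator
  with a generator lowers the order by one while looking at monomials one degree higher. The
  obstacle on the polynomial side is the available order on monomials: it is lexicographic, hence
  not well-founded once there are infinitely many variables (the variables themselves form a
  descending chain). Well-foundedness therefore has to be tied to a finite set of variables.
  Dickson's lemma serves twice, for this well-foundedness and for the chain argument behind
  noetherianity.\<close>

definition linear_forms :: "('a, 'm) ring_scheme \<Rightarrow> ('a, 'b, 'c) module_scheme \<Rightarrow> ('b \<Rightarrow> 'a) set" where
  "linear_forms R M =
     {f \<in> carrier M \<rightarrow> carrier R.
        (\<forall>u\<in>carrier M. \<forall>v\<in>carrier M. f (u \<oplus>\<^bsub>M\<^esub> v) = f u \<oplus>\<^bsub>R\<^esub> f v) \<and>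
        (\<forall>a\<in>carrier R. \<forall>u\<in>carrier M. f (a \<odot>\<^bsub>M\<^esub> u) = a \<otimes>\<^bsub>R\<^esub> f u)}"

context module
begin

lemma linear_formsD:
  assumes "f \<in> linear_forms R M"
  shows "u \<in> carrier M \<Longrightarrow> f u \<in> carrier R"
    and "u \<in> carrier M \<Longrightarrow> v \<in> carrier M \<Longrightarrow> f (u \<oplus>\<^bsub>M\<^esub> v) = f u \<oplus> f v"
    and "a \<in> carrier R \<Longrightarrow> u \<in> carrier M \<Longrightarrow> f (a \<odot>\<^bsub>M\<^esub> u) = a \<otimes> f u"
  using assms by (auto simp: linear_forms_def)

lemma linear_form_zero:
  assumes "f \<in> linear_forms R M"
  shows "f \<zero>\<^bsub>M\<^esub> = \<zero>"
proof -
  have "f (\<zero> \<odot>\<^bsub>M\<^esub> \<zero>\<^bsub>M\<^esub>) = \<zero> \<otimes> f \<zero>\<^bsub>M\<^esub>"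
    by (rule linear_formsD(3)[OF assms]) auto
  then show ?thesis
    using linear_formsD(1)[OF assms, of "\<zero>\<^bsub>M\<^esub>"] by simp
qed

lemma linear_form_minus:
  assumes "f \<in> linear_forms R M" "u \<in> carrier M"
  shows "f (\<ominus>\<^bsub>M\<^esub> u) = \<ominus> f u"
proof -
  have "f u \<oplus> f (\<ominus>\<^bsub>M\<^esub> u) = f (u \<oplus>\<^bsub>M\<^esub> \<ominus>\<^bsub>M\<^esub> u)"
    using assms by (simp add: linear_formsD(2))
  also have "\<dots> = \<zero>"
    using assms by (simp add: M.r_neg linear_form_zero)
  finally show ?thesis
    using assms linear_formsD(1) by (metis M.a_inv_closed R.add.m_comm R.minus_equality)
qed

lemma submodule_Int_kernel:
  assumes f: "f \<in> linear_forms R M" and N: "submodule N R M"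
  shows "submodule {u \<in> N. f u = \<zero>} R M"
proof (rule submoduleI)
  have sub: "N \<subseteq> carrier M" by (rule submoduleE(1)[OF N])
  show "\<zero>\<^bsub>M\<^esub> \<in> {u \<in> N. f u = \<zero>}"
    using f subgroup.one_closed[OF submodule.axioms(1)[OF N]] by (simp add: linear_form_zero)
qed (use submoduleE[OF N] f in \<open>auto simp: linear_form_minus linear_formsD subset_iff\<close>)

text \<open>A linear form turns submodules of \<open>M\<close> into submodules of \<open>R\<close>,
  and commutativity makes these two-sided ideals, the objects of which
  \<open>noetherian_ring\<close> speaks.\<close>

lemma ideal_image_linear_form:
  assumes f: "f \<in> linear_forms R M" and N: "submodule N R M"
  shows "ideal (f ` N) R"
proof (rule idealI)
  have sub: "u \<in> carrier M" if "u \<in> N" for u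
    using submoduleE(1)[OF N] that by auto
  show "subgroup (f ` N) (add_monoid R)"
  proof (rule group.subgroupI)
    show "group (add_monoid R)" by (rule R.a_group)
    show "f ` N \<subseteq> carrier (add_monoid R)"
      using linear_formsD(1)[OF f] sub by auto
    show "f ` N \<noteq> {}"
      using submoduleE(2)[OF N] by auto
    show "inv\<^bsub>add_monoid R\<^esub> a \<in> f ` N" if "a \<in> f ` N" for a
      using that submoduleE(3)[OF N] linear_form_minus[OF f] sub
      by (auto simp flip: a_inv_def) (metis image_eqI)
    show "a \<otimes>\<^bsub>add_monoid R\<^esub> b \<in> f ` N" if "a \<in> f ` N" "b \<in> f ` N" for a b
      using that submoduleE(5)[OF N] linear_formsD(2)[OF f] sub by auto (metis image_eqI)
  qed
  show "x \<otimes> a \<in> f ` N" if "a \<in> f ` N" "x \<in> carrier R" for a x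
    using that submoduleE(4)[OF N] linear_formsD(3)[OF f] sub by auto (metis image_eqI)
  then show "a \<otimes> x \<in> f ` N" if "a \<in> f ` N" "x \<in> carrier R" for a x
    using that linear_formsD(1)[OF f] sub by (metis (no_types, lifting) R.m_comm image_iff)
qed (rule R.ring_axioms)

text \<open>The induction must run over all submodules \<open>N\<close> at once, since dropping a
  form from \<open>F\<close> forces a passage to its kernel. Generation is expressed by testing
  against arbitrary submodules \<open>N'\<close>, which keeps linear combinations out of the
  argument.\<close>

lemma submodule_fin_gen_if_separated:
  assumes "noetherian_ring R" and "finite F" and "F \<subseteq> linear_forms R M"
    and "submodule N R M"
    and "\<And>u. u \<in> N \<Longrightarrow> \<forall>f\<in>F. f u = \<zero> \<Longrightarrow> u = \<zero>\<^bsub>M\<^esub>"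
  shows "\<exists>S. finite S \<and> S \<subseteq> N \<and> (\<forall>N'. submodule N' R M \<longrightarrow> S \<subseteq> N' \<longrightarrow> N \<subseteq> N')"
  using assms(2-)
proof (induction F arbitrary: N rule: finite_induct)
  case empty
  have "N \<subseteq> {\<zero>\<^bsub>M\<^esub>}"
    using empty.prems(3) by auto
  moreover have "\<zero>\<^bsub>M\<^esub> \<in> N'" if "submodule N' R M" for N'
    using subgroup.one_closed[OF submodule.axioms(1)[OF that]] by simp
  ultimately show ?case
    by (intro exI[of _ "{}"]) auto
next
  case (insert f F)
  \<comment> \<open>A submodule is generated by generators of the kernel of \<open>f\<close> and lifts of generators of its image.\<close>
  define N0 where "N0 = {u \<in> N. f u = \<zero>}"
  have f: "f \<in> linear_forms R M" using insert.prems(1) by simp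
  note N = insert.prems(2)
  have N0: "submodule N0 R M"
    unfolding N0_def using f N by (rule submodule_Int_kernel)
  obtain S0 where S0: "finite S0" "S0 \<subseteq> N0"
      "\<And>N'. submodule N' R M \<Longrightarrow> S0 \<subseteq> N' \<Longrightarrow> N0 \<subseteq> N'"
    using insert.IH[of N0] insert.prems N0 by (auto simp: N0_def)
  have "ideal (f ` N) R"
    using f N by (rule ideal_image_linear_form)
  then obtain B where B: "B \<subseteq> carrier R" "finite B" "f ` N = Idl B"
    using noetherian_ring.finetely_gen[OF assms(1)] by blast
  have "B \<subseteq> f ` N"
    using B by (simp add: R.genideal_self)
  then obtain S1 where S1: "S1 \<subseteq> N" "finite S1" "B = f ` S1"
    using B(2) by (meson finite_subset_image)
  show ?case
  proof (intro exI[of _ "S0 \<union> S1"] conjI allI impI subsetI)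
    show "finite (S0 \<union> S1)" using S0 S1 by simp
    show "u \<in> N" if "u \<in> S0 \<union> S1" for u using that S0 S1 by (auto simp: N0_def)
    fix N' u
    assume N': "submodule N' R M" "S0 \<union> S1 \<subseteq> N'" and u: "u \<in> N"
    \<comment> \<open>\<open>N'\<close> need not lie inside \<open>N\<close>. Intersecting makes the
      lift \<open>v\<close> of the value \<open>f u\<close> an element of both, so that the
      difference of \<open>u\<close> and \<open>v\<close> falls into the kernel
      \<open>N0\<close>.\<close>
    have int: "submodule (N \<inter> N') R M"
      using submoduleE[OF N] submoduleE[OF N'(1)]
        subgroup.one_closed[OF submodule.axioms(1)[OF N]]
        subgroup.one_closed[OF submodule.axioms(1)[OF N'(1)]]
      by (intro submoduleI) auto
    have "Idl B \<subseteq> f ` (N \<inter> N')"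
      using S1 N' by (intro R.genideal_minimal ideal_image_linear_form f int) auto
    then obtain v where v: "v \<in> N" "v \<in> N'" "f u = f v"
      using B(3) u by blast
    have carr: "u \<in> carrier M" "v \<in> carrier M"
      using u v submoduleE(1)[OF N] by auto
    have "u \<oplus>\<^bsub>M\<^esub> \<ominus>\<^bsub>M\<^esub> v \<in> N0"
      unfolding N0_def using u v carr submoduleE(3,5)[OF N] linear_formsD(1)[OF f]
      by (simp add: linear_formsD(2)[OF f] linear_form_minus[OF f] R.r_neg)
    then have "u \<oplus>\<^bsub>M\<^esub> \<ominus>\<^bsub>M\<^esub> v \<in> N'"
      using S0(3) N' by auto
    then have "(u \<oplus>\<^bsub>M\<^esub> \<ominus>\<^bsub>M\<^esub> v) \<oplus>\<^bsub>M\<^esub> v \<in> N'"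
      using v submoduleE(5)[OF N'(1)] by auto
    then show "u \<in> N'"
      using carr by (simp add: M.a_assoc M.l_neg)
  qed
qed

text \<open>The linear combinations of \<open>S\<close> are themselves a submodule containing
  \<open>S\<close>, so \<open>gen\<close> may be applied to them. This is the bridge from generation
  by submodules to the explicit sums in \<open>fin_gen_module\<close>.\<close>

lemma fin_gen_moduleI:
  assumes "finite S" "S \<subseteq> carrier M"
    and gen: "\<And>N. submodule N R M \<Longrightarrow> S \<subseteq> N \<Longrightarrow> carrier M \<subseteq> N"
  shows "fin_gen_module R M"
proof -
  define comb where "comb c = (\<Oplus>\<^bsub>M\<^esub>s\<in>S. c s \<odot>\<^bsub>M\<^esub> s)" for c
  define N where "N = comb ` (S \<rightarrow> carrier R)"
  have S: "s \<in> carrier M" if "s \<in> S" for s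
    using that assms(2) by auto
  have "S \<subseteq> N"
  proof
    fix t assume t: "t \<in> S"
    have "comb (\<lambda>s. if t = s then \<one> else \<zero>) = (\<Oplus>\<^bsub>M\<^esub>s\<in>S. if t = s then s else \<zero>\<^bsub>M\<^esub>)"
      unfolding comb_def by (rule M.finsum_cong') (auto simp: S)
    also have "\<dots> = t"
      using t S assms(1) by (subst M.finsum_singleton) auto
    finally show "t \<in> N"
      unfolding N_def by (intro image_eqI[of _ _ "\<lambda>s. if t = s then \<one> else \<zero>"]) auto
  qed
  moreover have "submodule N R M"
  proof (rule submoduleI)
    show "N \<subseteq> carrier M"
      unfolding N_def comb_def using S by (auto intro!: M.finsum_closed)
    have smult: "a \<odot>\<^bsub>M\<^esub> x \<in> N" if a: "a \<in> carrier R" and "x \<in> N" for a x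
    proof -
      obtain c where c: "c \<in> S \<rightarrow> carrier R" "x = comb c"
        using \<open>x \<in> N\<close> by (auto simp: N_def)
      have "a \<odot>\<^bsub>M\<^esub> x = (\<Oplus>\<^bsub>M\<^esub>s\<in>S. a \<odot>\<^bsub>M\<^esub> (c s \<odot>\<^bsub>M\<^esub> s))"
        unfolding c comb_def using a c S assms(1)
        by (subst finsum_smult_ldistr) auto
      also have "\<dots> = comb (\<lambda>s. a \<otimes> c s)"
        unfolding comb_def using a c S
        by (intro M.finsum_cong') (auto simp: Pi_iff smult_assoc1)
      finally show ?thesis
        unfolding N_def using a c by (intro image_eqI[of _ _ "\<lambda>s. a \<otimes> c s"]) auto
    qed
    show add: "x \<oplus>\<^bsub>M\<^esub> y \<in> N" if x: "x \<in> N" and y: "y \<in> N" for x y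
    proof -
      obtain c where c: "c \<in> S \<rightarrow> carrier R" "x = comb c"
        using x by (auto simp: N_def)
      obtain d where d: "d \<in> S \<rightarrow> carrier R" "y = comb d"
        using y by (auto simp: N_def)
      have "x \<oplus>\<^bsub>M\<^esub> y = (\<Oplus>\<^bsub>M\<^esub>s\<in>S. c s \<odot>\<^bsub>M\<^esub> s \<oplus>\<^bsub>M\<^esub> d s \<odot>\<^bsub>M\<^esub> s)"
        unfolding c d comb_def using c d S
        by (intro M.finsum_addf[symmetric]) auto
      also have "\<dots> = comb (\<lambda>s. c s \<oplus> d s)"
        unfolding comb_def using c d S
        by (intro M.finsum_cong') (auto simp: Pi_iff smult_l_distr)
      finally show ?thesis
        unfolding N_def using c d by (intro image_eqI[of _ _ "\<lambda>s. c s \<oplus> d s"]) auto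
    qed
    show "a \<odot>\<^bsub>M\<^esub> x \<in> N" if "a \<in> carrier R" "x \<in> N" for a x
      using that by (rule smult)
    have "comb (\<lambda>s. \<zero>) = (\<Oplus>\<^bsub>M\<^esub>s\<in>S. \<zero>\<^bsub>M\<^esub>)"
      unfolding comb_def by (rule M.finsum_cong') (auto simp: S)
    then show "\<zero>\<^bsub>M\<^esub> \<in> N"
      unfolding N_def by (intro image_eqI[of _ _ "\<lambda>s. \<zero>"]) auto
    show "\<ominus>\<^bsub>M\<^esub> x \<in> N" if x: "x \<in> N" for x
    proof -
      have "x \<in> carrier M" using x \<open>N \<subseteq> carrier M\<close> by auto
      then have "\<ominus>\<^bsub>M\<^esub> x = (\<ominus> \<one>) \<odot>\<^bsub>M\<^esub> x"
        by (simp add: smult_l_minus)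
      then show ?thesis using smult[OF _ x] by simp
    qed
  qed
  ultimately have "carrier M \<subseteq> N"
    using gen by blast
  then show ?thesis
    unfolding fin_gen_module_def using assms module_axioms
    by (fastforce simp: N_def comb_def)
qed

lemma fin_gen_module_if_separated:
  assumes "noetherian_ring R" and "finite F" and "F \<subseteq> linear_forms R M"
    and "\<And>u. u \<in> carrier M \<Longrightarrow> \<forall>f\<in>F. f u = \<zero> \<Longrightarrow> u = \<zero>\<^bsub>M\<^esub>"
  shows "fin_gen_module R M"
  using submodule_fin_gen_if_separated[OF assms(1-3) carrier_is_submodule assms(4)]
    fin_gen_moduleI by blast

end

section \<open>Differential operators on a finitely generated algebra\<close>

text \<open>Generation by \<open>X\<close> over the constants is put as an induction principle
  because it is used in this form: the elements with which a given endomorphism commutes make up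
  such a set \<open>T\<close>.\<close>

locale generated_algebra = cring A for A (structure) +
  fixes \<sigma> :: "'k \<Rightarrow> 'a" and X :: "'a set"
  assumes scalar_closed [simp]: "\<sigma> c \<in> carrier A"
    and finite_generators: "finite X"
    and generators_closed: "X \<subseteq> carrier A"
    and generated: "\<lbrakk>T \<subseteq> carrier A; range \<sigma> \<subseteq> T; X \<subseteq> T;
      \<And>a b. a \<in> T \<Longrightarrow> b \<in> T \<Longrightarrow> a \<oplus> b \<in> T; \<And>a b. a \<in> T \<Longrightarrow> b \<in> T \<Longrightarrow> a \<otimes> b \<in> T\<rbrakk>
      \<Longrightarrow> carrier A \<subseteq> T"
begin

section \<open>The module of K-linear endomorphisms\<close>

lemma End_alg_simps:
  "carrier (End_alg \<sigma> A) = K_endos \<sigma> A"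
  "u \<otimes>\<^bsub>End_alg \<sigma> A\<^esub> v = compose (carrier A) u v"
  "\<zero>\<^bsub>End_alg \<sigma> A\<^esub> = (\<lambda>x\<in>carrier A. \<zero>)"
  "u \<oplus>\<^bsub>End_alg \<sigma> A\<^esub> v = (\<lambda>x\<in>carrier A. u x \<oplus> v x)"
  "a \<odot>\<^bsub>End_alg \<sigma> A\<^esub> u = (\<lambda>x\<in>carrier A. a \<otimes> u x)"
  by (simp_all add: End_alg_def)

lemma K_endosD:
  assumes "u \<in> K_endos \<sigma> A"
  shows "x \<in> carrier A \<Longrightarrow> u x \<in> carrier A"
    and "x \<in> carrier A \<Longrightarrow> y \<in> carrier A \<Longrightarrow> u (x \<oplus> y) = u x \<oplus> u y"
    and "x \<in> carrier A \<Longrightarrow> u (\<sigma> c \<otimes> x) = \<sigma> c \<otimes> u x"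
    and "u \<in> extensional (carrier A)"
  using assms by (auto simp: K_endos_def PiE_iff)

lemma K_endos_eqI:
  assumes "u \<in> K_endos \<sigma> A" "v \<in> K_endos \<sigma> A" "\<And>x. x \<in> carrier A \<Longrightarrow> u x = v x"
  shows "u = v"
  using assms by (intro extensionalityI[OF K_endosD(4) K_endosD(4)])

lemma module_End_alg: "module A (End_alg \<sigma> A)"
proof (rule moduleI)
  show "abelian_group (End_alg \<sigma> A)"
  proof (rule abelian_groupI)
    fix u assume u: "u \<in> carrier (End_alg \<sigma> A)"
    have "(\<lambda>x\<in>carrier A. \<ominus> u x) \<in> K_endos \<sigma> A"
      using u by (auto simp: End_alg_simps K_endos_def PiE_iff minus_add r_minus)
    moreover have "(\<lambda>x\<in>carrier A. \<ominus> u x) \<oplus>\<^bsub>End_alg \<sigma> A\<^esub> u = \<zero>\<^bsub>End_alg \<sigma> A\<^esub>"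
      using u by (auto simp: End_alg_simps K_endosD l_neg)
    ultimately show "\<exists>v\<in>carrier (End_alg \<sigma> A). v \<oplus>\<^bsub>End_alg \<sigma> A\<^esub> u = \<zero>\<^bsub>End_alg \<sigma> A\<^esub>"
      unfolding End_alg_simps(1) by blast
  next
    fix u assume u: "u \<in> carrier (End_alg \<sigma> A)"
    then show "\<zero>\<^bsub>End_alg \<sigma> A\<^esub> \<oplus>\<^bsub>End_alg \<sigma> A\<^esub> u = u"
      by (auto simp: End_alg_simps K_endosD intro!: extensionalityI[of _ "carrier A"])
  qed (auto simp: End_alg_simps K_endos_def PiE_iff a_ac r_distr)
next
  fix u assume u: "u \<in> carrier (End_alg \<sigma> A)"
  then show "\<one> \<odot>\<^bsub>End_alg \<sigma> A\<^esub> u = u"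
    by (auto simp: End_alg_simps K_endosD intro!: extensionalityI[of _ "carrier A"])
qed (auto simp: End_alg_simps K_endos_def PiE_iff l_distr r_distr m_ac cring_axioms)

sublocale E: module A "End_alg \<sigma> A"
  by (rule module_End_alg)

text \<open>The negative in a module is an inverse given only by its property. Written as the scalar
  multiple by \<open>\<ominus> \<one>\<close> it becomes pointwise.\<close>

lemma End_alg_uminus_apply:
  assumes "u \<in> K_endos \<sigma> A" "x \<in> carrier A"
  shows "(\<ominus>\<^bsub>End_alg \<sigma> A\<^esub> u) x = \<ominus> u x"
proof -
  have "\<ominus>\<^bsub>End_alg \<sigma> A\<^esub> u = (\<ominus> \<one>) \<odot>\<^bsub>End_alg \<sigma> A\<^esub> u"
    using assms by (subst E.smult_l_minus) (auto simp: End_alg_simps(1))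
  then show ?thesis
    using assms by (simp add: End_alg_simps K_endosD l_minus)
qed

lemma mult_op_closed: "a \<in> carrier A \<Longrightarrow> mult_op A a \<in> K_endos \<sigma> A"
  by (auto simp: mult_op_def K_endos_def PiE_iff r_distr m_lcomm)

section \<open>Commutators and the order filtration\<close>

definition commutator :: "'a \<Rightarrow> ('a \<Rightarrow> 'a) \<Rightarrow> 'a \<Rightarrow> 'a" where
  "commutator a u = (\<lambda>x\<in>carrier A. a \<otimes> u x \<ominus> u (a \<otimes> x))"

text \<open>Replaces the ring expression in \<open>diff_ops_le\<close> by a formula for values, on
  which linearity and vanishing at monomials can be checked directly.\<close>

lemma commutator_eq:
  assumes "a \<in> carrier A" "u \<in> K_endos \<sigma> A"
  shows "mult_op A a \<otimes>\<^bsub>End_alg \<sigma> A\<^esub> u \<ominus>\<^bsub>End_alg \<sigma> A\<^esub> u \<otimes>\<^bsub>End_alg \<sigma> A\<^esub> mult_op A a = commutator a u"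
proof -
  have "compose (carrier A) u (mult_op A a) \<in> K_endos \<sigma> A"
    using assms
    by (auto simp: K_endos_def PiE_iff compose_def mult_op_def r_distr m_lcomm[of a "\<sigma> _"])
  then show ?thesis
    using assms
    by (auto simp: a_minus_def End_alg_simps End_alg_uminus_apply commutator_def compose_def
        mult_op_def K_endosD)
qed

lemma diff_ops_le_Suc_iff:
  "u \<in> diff_ops_le \<sigma> A (Suc i) \<longleftrightarrow>
     u \<in> K_endos \<sigma> A \<and> (\<forall>a\<in>carrier A. commutator a u \<in> diff_ops_le \<sigma> A i)"
  by (auto simp: commutator_eq End_alg_simps(1))

lemma diff_ops_le_subset: "diff_ops_le \<sigma> A i \<subseteq> K_endos \<sigma> A"
  by (cases i) (auto simp: diff_ops_le_Suc_iff mult_op_closed simp del: diff_ops_le.simps(2))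

lemma commutator_add:
  assumes "a \<in> carrier A" "u \<in> K_endos \<sigma> A" "v \<in> K_endos \<sigma> A"
  shows "commutator a (u \<oplus>\<^bsub>End_alg \<sigma> A\<^esub> v) = commutator a u \<oplus>\<^bsub>End_alg \<sigma> A\<^esub> commutator a v"
  using assms
  by (auto simp: commutator_def End_alg_simps K_endosD a_minus_def r_distr minus_add a_ac)

text \<open>The factor \<open>b\<close> comes out because \<open>a\<close> and \<open>b\<close>
  commute in \<open>A\<close>; this is what makes the levels of the filtration left
  \<open>A\<close>-modules.\<close>

lemma commutator_smult:
  assumes "a \<in> carrier A" "b \<in> carrier A" "u \<in> K_endos \<sigma> A"
  shows "commutator a (b \<odot>\<^bsub>End_alg \<sigma> A\<^esub> u) = b \<odot>\<^bsub>End_alg \<sigma> A\<^esub> commutator a u"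
  using assms
  by (auto simp: commutator_def End_alg_simps K_endosD a_minus_def r_distr r_minus m_lcomm)

text \<open>Taking commutators with a fixed \<open>a\<close> is \<open>A\<close>-linear, so level
  \<open>Suc i\<close> is an intersection of preimages of level \<open>i\<close>. Only sums and
  multiples go through the induction; negatives are multiples by
  \<open>\<ominus> \<one>\<close>.\<close>

lemma submodule_diff_ops_le: "submodule (diff_ops_le \<sigma> A i) A (End_alg \<sigma> A)"
proof -
  have closed: "(\<forall>u\<in>diff_ops_le \<sigma> A i. \<forall>v\<in>diff_ops_le \<sigma> A i. u \<oplus>\<^bsub>End_alg \<sigma> A\<^esub> v \<in> diff_ops_le \<sigma> A i)
     \<and> (\<forall>b\<in>carrier A. \<forall>u\<in>diff_ops_le \<sigma> A i. b \<odot>\<^bsub>End_alg \<sigma> A\<^esub> u \<in> diff_ops_le \<sigma> A i)"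
  proof (induction i)
    case 0
    have "mult_op A a \<oplus>\<^bsub>End_alg \<sigma> A\<^esub> mult_op A b = mult_op A (a \<oplus> b)"
      "b \<odot>\<^bsub>End_alg \<sigma> A\<^esub> mult_op A a = mult_op A (b \<otimes> a)"
      if "a \<in> carrier A" "b \<in> carrier A" for a b
      using that by (auto simp: End_alg_simps mult_op_def l_distr m_assoc)
    then show ?case by auto
  next
    case (Suc i)
    then show ?case
      using E.a_closed E.smult_closed
      by (auto simp: diff_ops_le_Suc_iff commutator_add commutator_smult End_alg_simps(1)
          simp del: diff_ops_le.simps(2))
  qed
  have minus_one: "\<ominus>\<^bsub>End_alg \<sigma> A\<^esub> u = (\<ominus> \<one>) \<odot>\<^bsub>End_alg \<sigma> A\<^esub> u" if "u \<in> K_endos \<sigma> A" for u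
    using that by (subst E.smult_l_minus) (auto simp: End_alg_simps(1))
  have zero: "\<zero>\<^bsub>End_alg \<sigma> A\<^esub> \<in> diff_ops_le \<sigma> A i"
  proof (induction i)
    case 0
    have "\<zero>\<^bsub>End_alg \<sigma> A\<^esub> = mult_op A \<zero>"
      by (auto simp: End_alg_simps mult_op_def)
    then show ?case by auto
  next
    case (Suc i)
    have "commutator a \<zero>\<^bsub>End_alg \<sigma> A\<^esub> = \<zero>\<^bsub>End_alg \<sigma> A\<^esub>" if "a \<in> carrier A" for a
      using that by (auto simp: commutator_def End_alg_simps a_minus_def)
    then show ?case
      using Suc E.zero_closed
      by (simp add: diff_ops_le_Suc_iff End_alg_simps(1) del: diff_ops_le.simps(2))
  qed
  show ?thesis
  proof (rule E.submoduleI)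
    fix u assume "u \<in> diff_ops_le \<sigma> A i"
    then show "\<ominus>\<^bsub>End_alg \<sigma> A\<^esub> u \<in> diff_ops_le \<sigma> A i"
      using minus_one[of u] diff_ops_le_subset[of i] closed by (auto simp: subset_iff)
  qed (use closed zero diff_ops_le_subset in \<open>auto simp: End_alg_simps(1)\<close>)
qed

section \<open>Vanishing on monomials of bounded degree\<close>

primrec monomials_le :: "nat \<Rightarrow> 'a set" where
  "monomials_le 0 = {\<one>}"
| "monomials_le (Suc i) = insert \<one> ((\<lambda>(x, m). x \<otimes> m) ` (X \<times> monomials_le i))"

lemma finite_monomials_le: "finite (monomials_le i)"
  by (induction i) (simp_all add: finite_generators)

lemma monomials_le_closed: "monomials_le i \<subseteq> carrier A"
  using generators_closed by (induction i) auto

text \<open>The \<open>\<one>\<close> inserted at every level makes the sets increase. The value of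
  \<open>commutator x u\<close> at \<open>m\<close> involves \<open>u\<close> at \<open>m\<close> as
  well as at \<open>x \<otimes> m\<close>, so both degrees must be present at the next
  level.\<close>

lemma monomials_le_mono: "monomials_le i \<subseteq> monomials_le (Suc i)"
proof (induction i)
  case (Suc i)
  then have "X \<times> monomials_le i \<subseteq> X \<times> monomials_le (Suc i)" by blast
  then show ?case
    unfolding monomials_le.simps(2)[of "Suc i"] monomials_le.simps(2)[of i]
    by (intro insert_mono image_mono) (simp only: monomials_le.simps)
qed simp

text \<open>The elements whose multiplication commutes with \<open>u\<close> are closed under sums
  and products and contain the constants by K-linearity. Commuting with the generators thus makes
  \<open>u\<close> an \<open>A\<close>-linear map, determined by its value at
  \<open>\<one>\<close>.\<close>

lemma K_endo_eq_zero_if_commutes: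
  assumes u: "u \<in> K_endos \<sigma> A" and "u \<one> = \<zero>"
    and comm: "\<And>x y. x \<in> X \<Longrightarrow> y \<in> carrier A \<Longrightarrow> u (x \<otimes> y) = x \<otimes> u y"
  shows "u = \<zero>\<^bsub>End_alg \<sigma> A\<^esub>"
proof (rule K_endos_eqI[OF u])
  define T where "T = {a \<in> carrier A. \<forall>y\<in>carrier A. u (a \<otimes> y) = a \<otimes> u y}"
  have "carrier A \<subseteq> T"
  proof (rule generated)
    show "range \<sigma> \<subseteq> T" "X \<subseteq> T"
      using u comm generators_closed by (auto simp: T_def K_endosD)
    show "a \<oplus> b \<in> T" "a \<otimes> b \<in> T" if "a \<in> T" "b \<in> T" for a b
      using that u by (auto simp: T_def K_endosD l_distr m_assoc)
  qed (auto simp: T_def)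
  then have "u (x \<otimes> \<one>) = x \<otimes> u \<one>" if "x \<in> carrier A" for x
    using that by (auto simp: T_def simp del: r_one dest: subsetD)
  then show "u x = \<zero>\<^bsub>End_alg \<sigma> A\<^esub> x" if "x \<in> carrier A" for x
    using that \<open>u \<one> = \<zero>\<close> by (simp add: End_alg_simps)
  show "\<zero>\<^bsub>End_alg \<sigma> A\<^esub> \<in> K_endos \<sigma> A"
    using E.zero_closed by (simp add: End_alg_simps(1))
qed

lemma diff_op_eq_zero_if_vanishes:
  assumes "u \<in> diff_ops_le \<sigma> A i" and "\<forall>m\<in>monomials_le i. u m = \<zero>"
  shows "u = \<zero>\<^bsub>End_alg \<sigma> A\<^esub>"
  using assms
proof (induction i arbitrary: u)
  case 0
  then obtain a where "a \<in> carrier A" "u = mult_op A a" by auto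
  with 0 show ?case
    by (auto simp: mult_op_def End_alg_simps)
next
  case (Suc i)
  have u: "u \<in> K_endos \<sigma> A" and comm: "\<And>a. a \<in> carrier A \<Longrightarrow> commutator a u \<in> diff_ops_le \<sigma> A i"
    using Suc.prems(1) by (auto simp: diff_ops_le_Suc_iff simp del: diff_ops_le.simps(2))
  show ?case
  proof (rule K_endo_eq_zero_if_commutes[OF u])
    show "u \<one> = \<zero>" using Suc.prems(2) by simp
    fix x y assume x: "x \<in> X" and y: "y \<in> carrier A"
    have xA: "x \<in> carrier A" using x generators_closed by auto
    have "commutator x u m = \<zero>" if m: "m \<in> monomials_le i" for m
    proof -
      have "u (x \<otimes> m) = \<zero>" using Suc.prems(2) x m by auto
      moreover have "u m = \<zero>"
        using Suc.prems(2) m monomials_le_mono by blast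
      ultimately show ?thesis
        using m monomials_le_closed xA by (auto simp: commutator_def a_minus_def)
    qed
    then have "commutator x u = \<zero>\<^bsub>End_alg \<sigma> A\<^esub>"
      using Suc.IH comm xA by blast
    then have "commutator x u y = \<zero>"
      using y by (simp add: End_alg_simps)
    then show "u (x \<otimes> y) = x \<otimes> u y"
      using xA y u by (simp add: commutator_def K_endosD)
  qed
qed

theorem fin_gen_diff_ops_le:
  assumes "noetherian_ring A"
  shows "fin_gen_module A ((diff_ops \<sigma> A)\<lparr>carrier := diff_ops_le \<sigma> A i\<rparr>)"
proof -
  have eq: "(diff_ops \<sigma> A)\<lparr>carrier := diff_ops_le \<sigma> A i\<rparr> = (End_alg \<sigma> A)\<lparr>carrier := diff_ops_le \<sigma> A i\<rparr>"
    by (simp add: diff_ops_def)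
  interpret D: module A "(End_alg \<sigma> A)\<lparr>carrier := diff_ops_le \<sigma> A i\<rparr>"
    by (rule submodule.submodule_is_module[OF submodule_diff_ops_le module_End_alg])
  show ?thesis
    unfolding eq
  proof (rule D.fin_gen_module_if_separated[OF assms])
    show "finite ((\<lambda>m u. u m) ` monomials_le i)"
      by (simp add: finite_monomials_le)
    \<comment> \<open>Sums and scalar multiples of operators are pointwise, so evaluation at a fixed
      element is \<open>A\<close>-linear. As \<open>linear_forms\<close> imposes no extensionality,
      the bare evaluation map qualifies.\<close>
    show "(\<lambda>m u. u m) ` monomials_le i \<subseteq>
        linear_forms A ((End_alg \<sigma> A)\<lparr>carrier := diff_ops_le \<sigma> A i\<rparr>)"
      using diff_ops_le_subset[of i] monomials_le_closed[of i]
      by (auto simp: linear_forms_def End_alg_simps K_endosD subset_iff)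
    show "u = \<zero>\<^bsub>(End_alg \<sigma> A)\<lparr>carrier := diff_ops_le \<sigma> A i\<rparr>\<^esub>"
      if "u \<in> carrier ((End_alg \<sigma> A)\<lparr>carrier := diff_ops_le \<sigma> A i\<rparr>)"
        "\<forall>f\<in>(\<lambda>m u. u m) ` monomials_le i. f u = \<zero>" for u
      using that diff_op_eq_zero_if_vanishes[of u i] by simp
  qed
qed

end

section \<open>Polynomial rings and their quotients\<close>

lemma mono_nat_subseq:
  fixes h :: "nat \<Rightarrow> nat"
  obtains r :: "nat \<Rightarrow> nat" where "strict_mono r" "mono (\<lambda>k. h (r k))"
proof -
  obtain q :: "nat \<Rightarrow> nat" where q: "strict_mono q" "monoseq (\<lambda>k. h (q k))"
    using seq_monosub by blast
  show thesis
  proof (cases "\<forall>m. \<forall>k\<ge>m. h (q m) \<le> h (q k)")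
    case True
    then show thesis using q that by (auto simp: mono_def)
  next
    case False
    then have decr: "h (q k) \<le> h (q m)" if "m \<le> k" for m k
      using q(2) that unfolding monoseq_def by blast
    \<comment> \<open>A decreasing sequence of natural numbers is constant from the index of its
      least value on, so its tail is also increasing.\<close>
    obtain k0 where k0: "\<And>k. h (q k0) \<le> h (q k)"
      using ex_has_least_nat[of "\<lambda>_. True" _ "\<lambda>k. h (q k)"] by auto
    have "h (q (k0 + k)) = h (q k0)" for k
      using k0 decr by (simp add: order_antisym)
    moreover have "strict_mono (\<lambda>k. q (k0 + k))"
      using q(1) by (simp add: strict_mono_def)
    ultimately show thesis
      using that[of "\<lambda>k. q (k0 + k)"] by (simp add: mono_def)
  qed
qed

text \<open>The coordinates are treated one after the other: monotonicity already achieved survives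
  every further passage to a subsequence.\<close>

lemma mono_subseq_on_finite:
  fixes g :: "nat \<Rightarrow> 'v \<Rightarrow> nat"
  assumes "finite V"
  obtains r :: "nat \<Rightarrow> nat" where "strict_mono r" "\<And>v. v \<in> V \<Longrightarrow> mono (\<lambda>k. g (r k) v)"
  using assms
proof (induction V arbitrary: thesis rule: finite_induct)
  case empty
  show ?case by (rule empty[of id]) (auto simp: strict_mono_def)
next
  case (insert w V)
  obtain r :: "nat \<Rightarrow> nat" where r: "strict_mono r" "\<And>v. v \<in> V \<Longrightarrow> mono (\<lambda>k. g (r k) v)"
    using insert.IH by blast
  obtain q :: "nat \<Rightarrow> nat" where q: "strict_mono q" "mono (\<lambda>k. g (r (q k)) w)"
    using mono_nat_subseq[of "\<lambda>k. g (r k) w"] by blast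
  show ?case
  proof (rule insert.prems)
    show "strict_mono (r \<circ> q)" using r(1) q(1) by (rule strict_mono_o)
    show "mono (\<lambda>k. g ((r \<circ> q) k) v)" if "v \<in> insert w V" for v
      using that r(2) q strict_mono_mono[OF q(1)] by (auto simp: mono_def)
  qed
qed

text \<open>For exponents, \<open>f j = f i + d\<close> is divisibility of monomials. The bound on
  the keys of \<open>d\<close> keeps the cofactor in the same polynomial ring.\<close>

lemma dickson:
  fixes f :: "nat \<Rightarrow> 'v \<Rightarrow>\<^sub>0 nat"
  assumes "finite V" "\<And>k. Poly_Mapping.keys (f k) \<subseteq> V"
  obtains i j d where "i < j" "f j = f i + d" "Poly_Mapping.keys d \<subseteq> V"
proof -
  obtain r :: "nat \<Rightarrow> nat" where r: "strict_mono r" "\<And>v. v \<in> V \<Longrightarrow> mono (\<lambda>k. Poly_Mapping.lookup (f (r k)) v)"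
    using mono_subseq_on_finite[OF assms(1), of "\<lambda>k. Poly_Mapping.lookup (f k)"] by blast
  have le: "Poly_Mapping.lookup (f (r 0)) v \<le> Poly_Mapping.lookup (f (r 1)) v" for v
  proof (cases "v \<in> V")
    case True
    then show ?thesis using monoD[OF r(2), of v 0 1] by simp
  next
    case False
    then have "v \<notin> Poly_Mapping.keys (f (r 0))" using assms(2)[of "r 0"] by blast
    then show ?thesis by (simp add: in_keys_iff)
  qed
  show thesis
  proof (rule that)
    show "r 0 < r 1" using r(1) by (simp add: strict_mono_def)
    \<comment> \<open>Subtraction of exponents is truncated; \<open>le\<close> makes it
      exact.\<close>
    show "f (r 1) = f (r 0) + (f (r 1) - f (r 0))"
      using le by (intro poly_mapping_eqI) (simp add: lookup_add lookup_minus)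
    show "Poly_Mapping.keys (f (r 1) - f (r 0)) \<subseteq> V"
      using assms(2)[of "r 1"] by (auto simp: in_keys_iff lookup_minus)
  qed
qed

text \<open>The order is lexicographic, decided at the least variable where two exponents differ;
  there an exponent would have to be a natural number below zero.\<close>

lemma poly_mapping_nat_nonneg: "0 \<le> (d :: 'v::linorder \<Rightarrow>\<^sub>0 nat)"
proof -
  have "\<not> d < 0"
    by transfer (simp add: less_fun_def)
  then show ?thesis by simp
qed

text \<open>In a descending sequence Dickson's lemma finds an earlier monomial dividing a later one.
  Adding an exponent never decreases a monomial, so the later one would not be smaller.\<close>

lemma wf_monomials:
  fixes V :: "'v::linorder set"
  assumes "finite V"
  shows "wf {(m, m' :: 'v \<Rightarrow>\<^sub>0 nat). Poly_Mapping.keys m \<subseteq> V \<and> Poly_Mapping.keys m' \<subseteq> V \<and> m < m'}"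
  unfolding wf_iff_no_infinite_down_chain
proof (rule notI, elim exE)
  fix f assume f: "\<forall>i. (f (Suc i), f i) \<in>
    {(m, m' :: 'v \<Rightarrow>\<^sub>0 nat). Poly_Mapping.keys m \<subseteq> V \<and> Poly_Mapping.keys m' \<subseteq> V \<and> m < m'}"
  then have "Poly_Mapping.keys (f k) \<subseteq> V" for k
    by auto
  then obtain i j d where "i < j" "f j = f i + d"
    using dickson[OF assms, of f] by metis
  then have "f i \<le> f j"
    using add_left_mono[OF poly_mapping_nat_nonneg, of "f i" d] by simp
  moreover have "f (Suc k) \<le> f k" for k
    using f by (auto intro: less_imp_le)
  then have "f j \<le> f (Suc i)"
    using lift_Suc_antimono_le[of f "Suc i" j] \<open>i < j\<close> by simp
  moreover have "f (Suc i) < f i"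
    using f by simp
  ultimately show False by simp
qed

section \<open>Polynomials in a given set of variables\<close>

definition mpolys :: "'v set \<Rightarrow> (('v \<Rightarrow>\<^sub>0 nat) \<Rightarrow>\<^sub>0 'k::field) set" where
  "mpolys V = {p. \<forall>m\<in>Poly_Mapping.keys p. Poly_Mapping.keys m \<subseteq> V}"

lemma mpolys_add: "p \<in> mpolys V \<Longrightarrow> q \<in> mpolys V \<Longrightarrow> p + q \<in> mpolys V"
  using Poly_Mapping.keys_add[of p q] by (auto simp: mpolys_def)

lemma mpolys_mult:
  assumes "p \<in> mpolys V" "q \<in> mpolys V"
  shows "p * q \<in> mpolys V"
  unfolding mpolys_def
proof (intro CollectI ballI)
  fix m assume "m \<in> Poly_Mapping.keys (p * q)"
  then obtain a b where "m = a + b" "a \<in> Poly_Mapping.keys p" "b \<in> Poly_Mapping.keys q"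
    using keys_mult[of p q] by blast
  then show "Poly_Mapping.keys m \<subseteq> V"
    using assms Poly_Mapping.keys_add[of a b] unfolding mpolys_def by blast
qed

lemma mpolys_uminus: "p \<in> mpolys V \<Longrightarrow> - p \<in> mpolys V"
  by (simp add: mpolys_def in_keys_iff)

lemma single_in_mpolys: "Poly_Mapping.keys m \<subseteq> V \<Longrightarrow> Poly_Mapping.single m c \<in> mpolys V"
  by (simp add: mpolys_def)

lemma mpoly_ring_simps:
  "carrier (mpoly_ring n) = mpolys {1..n}"
  "p \<otimes>\<^bsub>mpoly_ring n\<^esub> q = p * q"
  "p \<oplus>\<^bsub>mpoly_ring n\<^esub> q = p + q"
  "\<one>\<^bsub>mpoly_ring n\<^esub> = 1"
  "\<zero>\<^bsub>mpoly_ring n\<^esub> = 0"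
  by (simp_all add: mpoly_ring_def mpolys_def)

lemma cring_mpoly_ring: "cring (mpoly_ring n :: ((nat \<Rightarrow>\<^sub>0 nat) \<Rightarrow>\<^sub>0 'k::field) ring)"
  (is "cring ?P")
proof (rule cringI)
  show "abelian_group ?P"
  proof (rule abelian_groupI)
    fix p :: "(nat \<Rightarrow>\<^sub>0 nat) \<Rightarrow>\<^sub>0 'k" assume "p \<in> carrier ?P"
    then show "\<exists>q\<in>carrier ?P. q \<oplus>\<^bsub>?P\<^esub> p = \<zero>\<^bsub>?P\<^esub>"
      by (intro bexI[of _ "- p"]) (auto simp: mpoly_ring_simps mpolys_uminus)
  qed (auto simp: mpoly_ring_simps mpolys_add algebra_simps, auto simp: mpolys_def)
  show "Group.comm_monoid ?P"
  proof (rule comm_monoidI)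
    show "\<one>\<^bsub>?P\<^esub> \<in> carrier ?P"
      by (auto simp: mpoly_ring_simps mpolys_def)
  qed (auto simp: mpoly_ring_simps mpolys_mult algebra_simps)
qed (simp add: mpoly_ring_simps algebra_simps)

section \<open>Leading monomials and Hilbert's basis theorem\<close>

definition lead_monomial :: "('m::linorder \<Rightarrow>\<^sub>0 'k::zero) \<Rightarrow> 'm" where
  "lead_monomial p = Max (Poly_Mapping.keys p)"

text \<open>The zero polynomial has to be excluded: its leading monomial is the unspecified value
  \<open>Max {}\<close>.\<close>

lemma lead_monomial_in_keys: "p \<noteq> 0 \<Longrightarrow> lead_monomial p \<in> Poly_Mapping.keys p"
  unfolding lead_monomial_def by (intro Max_in) auto

lemma le_lead_monomial: "m \<in> Poly_Mapping.keys p \<Longrightarrow> m \<le> lead_monomial p"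
  unfolding lead_monomial_def by simp

text \<open>One step of polynomial division: \<open>c\<close> is the quotient of the leading
  coefficients, and adding \<open>d\<close> preserves the order of monomials, so after cancellation
  only the tails contribute. The conclusion speaks of keys because the difference may be
  zero.\<close>

lemma cancel_lead_monomial:
  fixes p q :: "('v::linorder \<Rightarrow>\<^sub>0 nat) \<Rightarrow>\<^sub>0 'k::field"
  assumes "p \<noteq> 0" "q \<noteq> 0" and lead: "lead_monomial p = lead_monomial q + d"
  obtains c where "\<And>m. m \<in> Poly_Mapping.keys (p - Poly_Mapping.single d c * q) \<Longrightarrow> m < lead_monomial p"
proof -
  define tail where "tail f = f - Poly_Mapping.single (lead_monomial f) (Poly_Mapping.lookup f (lead_monomial f))"
    for f :: "('v \<Rightarrow>\<^sub>0 nat) \<Rightarrow>\<^sub>0 'k"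
  have tail: "m < lead_monomial f" if "m \<in> Poly_Mapping.keys (tail f)" for m f
  proof -
    have "m \<in> Poly_Mapping.keys f \<and> m \<noteq> lead_monomial f"
      using that by (auto simp: tail_def in_keys_iff lookup_minus lookup_single when_def split: if_splits)
    then show ?thesis using le_lead_monomial[of m f] by auto
  qed
  define c where "c = Poly_Mapping.lookup p (lead_monomial p) / Poly_Mapping.lookup q (lead_monomial q)"
  have "Poly_Mapping.lookup q (lead_monomial q) \<noteq> 0"
    using lead_monomial_in_keys[OF \<open>q \<noteq> 0\<close>] by (simp add: in_keys_iff)
  then have "Poly_Mapping.single d c * q =
      Poly_Mapping.single (lead_monomial p) (Poly_Mapping.lookup p (lead_monomial p))
        + Poly_Mapping.single d c * tail q"
    unfolding tail_def lead
    by (simp add: algebra_simps mult_single c_def lead)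
  then have eq: "p - Poly_Mapping.single d c * q = tail p - Poly_Mapping.single d c * tail q"
    unfolding tail_def[of p] by simp
  show thesis
  proof (rule that)
    fix m assume "m \<in> Poly_Mapping.keys (p - Poly_Mapping.single d c * q)"
    then consider "m \<in> Poly_Mapping.keys (tail p)" | "m \<in> Poly_Mapping.keys (Poly_Mapping.single d c * tail q)"
      unfolding eq by (fastforce simp: in_keys_iff lookup_minus)
    then show "m < lead_monomial p"
    proof cases
      case 1
      then show ?thesis by (rule tail)
    next
      case 2
      then obtain k where "k \<in> Poly_Mapping.keys (tail q)" "m = d + k"
        using keys_mult[of "Poly_Mapping.single d c" "tail q"] by (auto split: if_splits)
      then show ?thesis
        using tail[of k q] by (simp add: lead add.commute[of d])
    qed
  qed
qed

lemma noetherian_mpoly_ring: "noetherian_ring (mpoly_ring n :: ((nat \<Rightarrow>\<^sub>0 nat) \<Rightarrow>\<^sub>0 'k::field) ring)"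
proof -
  let ?P = "mpoly_ring n :: ((nat \<Rightarrow>\<^sub>0 nat) \<Rightarrow>\<^sub>0 'k) ring"
  interpret P: cring ?P by (rule cring_mpoly_ring)
  show ?thesis
  proof (rule P.noetherian_ringI, rule ccontr)
    fix J assume J: "ideal J ?P"
      and nfg: "\<not> (\<exists>S\<subseteq>carrier ?P. finite S \<and> J = Idl\<^bsub>?P\<^esub> S)"
    have J_sub: "J \<subseteq> carrier ?P"
      using additive_subgroup.a_subset[OF ideal.axioms(1)[OF J]] .
    have sub_mult_mem: "p - s * q \<in> L" if "ideal L ?P" "p \<in> L" "q \<in> L" "s \<in> carrier ?P" for p q s L
    proof -
      have "- s * q \<in> L"
        using ideal.I_l_closed[OF that(1,3), of "- s"] that(4) by (simp add: mpoly_ring_simps mpolys_uminus)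
      then show ?thesis
        using additive_subgroup.a_closed[OF ideal.axioms(1)[OF that(1)], of p "- s * q"] that(2)
        by (simp add: mpoly_ring_simps)
    qed
    \<comment> \<open>Each new element of the sequence \<open>f\<close> below has the least leading monomial outside the ideal
      generated by its predecessors, so no earlier leading monomial divides it.\<close>
    define minimal where "minimal S p \<longleftrightarrow> p \<in> J - Idl\<^bsub>?P\<^esub> S \<and>
      (\<forall>q\<in>J - Idl\<^bsub>?P\<^esub> S. \<not> lead_monomial q < lead_monomial p)" for S p
    \<comment> \<open>Zero lies in every ideal, so all candidates outside \<open>Idl S\<close> have
      a genuine leading monomial.\<close>
    have nonzero: "p \<noteq> 0" if "p \<in> J - Idl\<^bsub>?P\<^esub> S" "S \<subseteq> J" for p S
    proof -
      have "ideal (Idl\<^bsub>?P\<^esub> S) ?P"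
        using that J_sub by (intro P.genideal_ideal) auto
      from additive_subgroup.zero_closed[OF ideal.axioms(1)[OF this]]
      have "0 \<in> Idl\<^bsub>?P\<^esub> S"
        by (simp only: mpoly_ring_simps)
      then show ?thesis using that by auto
    qed
    have lead_sub: "Poly_Mapping.keys (lead_monomial p) \<subseteq> {1..n}" if "p \<in> J" "p \<noteq> 0" for p
      using that J_sub lead_monomial_in_keys[of p] by (auto simp: mpoly_ring_simps mpolys_def)
    have "\<exists>p. minimal S p" if S: "finite S" "S \<subseteq> J" for S
    proof -
      have "Idl\<^bsub>?P\<^esub> S \<subseteq> J"
        using J S by (intro P.genideal_minimal)
      moreover have "Idl\<^bsub>?P\<^esub> S \<noteq> J"
        using nfg S J_sub by blast
      ultimately obtain p0 where p0: "p0 \<in> J - Idl\<^bsub>?P\<^esub> S" by blast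
      then have "lead_monomial p0 \<in> lead_monomial ` (J - Idl\<^bsub>?P\<^esub> S)" by blast
      \<comment> \<open>The well-founded relation compares only monomials in the first
        \<open>n\<close> variables; \<open>lead_sub\<close> later confirms that all competitors are
        of this kind.\<close>
      from wfE_min[OF wf_monomials[of "{1..n}"] this] obtain m where
        m: "m \<in> lead_monomial ` (J - Idl\<^bsub>?P\<^esub> S)"
        and min: "\<And>m'. (m', m) \<in> {(m, m'). Poly_Mapping.keys m \<subseteq> {1..n} \<and>
            Poly_Mapping.keys m' \<subseteq> {1..n} \<and> m < m'} \<Longrightarrow> m' \<notin> lead_monomial ` (J - Idl\<^bsub>?P\<^esub> S)"
        by blast
      from m obtain p where p: "p \<in> J - Idl\<^bsub>?P\<^esub> S" "m = lead_monomial p" by blast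
      have "\<not> lead_monomial q < lead_monomial p" if q: "q \<in> J - Idl\<^bsub>?P\<^esub> S" for q
        using min[of "lead_monomial q"] p q lead_sub[of p] lead_sub[of q] nonzero[OF _ S(2)] by blast
      then show ?thesis
        using p unfolding minimal_def by blast
    qed
    then obtain g where g: "\<And>S. finite S \<Longrightarrow> S \<subseteq> J \<Longrightarrow> minimal S (g S)" by metis
    \<comment> \<open>\<open>S k\<close> collects the first \<open>k\<close> choices. Recursion on
      the set of predecessors makes each choice depend on all earlier ones by plain primitive
      recursion.\<close>
    define S where "S = rec_nat {} (\<lambda>_ T. insert (g T) T)"
    have S_Suc: "S (Suc k) = insert (g (S k)) (S k)" and S_0: "S 0 = {}" for k
      by (simp_all add: S_def)
    have S: "finite (S k) \<and> S k \<subseteq> J" for k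
      using g by (induction k) (auto simp: S_0 S_Suc minimal_def)
    define f where "f k = g (S k)" for k
    have f: "minimal (S k) (f k)" for k
      unfolding f_def using g S by blast
    then have f_J: "f k \<in> J" "f k \<noteq> 0" for k
      using nonzero S unfolding minimal_def by blast+
    obtain i j d where ij: "i < j" and lead: "lead_monomial (f j) = lead_monomial (f i) + d"
      and d: "Poly_Mapping.keys d \<subseteq> {1..n}"
      using dickson[of "{1..n}" "\<lambda>k. lead_monomial (f k)"] lead_sub f_J by blast
    obtain c where c: "\<And>m. m \<in> Poly_Mapping.keys (f j - Poly_Mapping.single d c * f i) \<Longrightarrow> m < lead_monomial (f j)"
      using cancel_lead_monomial[OF f_J(2) f_J(2) lead] by blast
    \<comment> \<open>\<open>r\<close> is to be a better candidate than \<open>f j\<close>: still in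
      \<open>J\<close> and outside the ideal of the predecessors, but with a smaller leading
      monomial.\<close>
    define r where "r = f j - Poly_Mapping.single d c * f i"
    have single: "Poly_Mapping.single d e \<in> carrier ?P" for e
      using d by (simp add: mpoly_ring_simps single_in_mpolys)
    have "f i \<in> S (Suc i)" by (simp add: S_Suc f_def)
    moreover have "S k \<subseteq> S (Suc k)" for k
      by (auto simp: S_Suc)
    then have "S (Suc i) \<subseteq> S j"
      using lift_Suc_mono_le[of S "Suc i" j] ij by simp
    ultimately have "f i \<in> S j" by blast
    have id: "ideal (Idl\<^bsub>?P\<^esub> (S j)) ?P"
      using S J_sub by (intro P.genideal_ideal) blast
    have fi: "f i \<in> Idl\<^bsub>?P\<^esub> (S j)"
      using P.genideal_self[of "S j"] S[of j] J_sub \<open>f i \<in> S j\<close> by blast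
    have "r \<in> J"
      unfolding r_def using J f_J single by (intro sub_mult_mem)
    moreover have "r \<notin> Idl\<^bsub>?P\<^esub> (S j)"
    proof
      assume "r \<in> Idl\<^bsub>?P\<^esub> (S j)"
      \<comment> \<open>The coefficient \<open>- c\<close> undoes the cancellation, so this
        difference is \<open>f j\<close> again.\<close>
      then have "r - Poly_Mapping.single d (- c) * f i \<in> Idl\<^bsub>?P\<^esub> (S j)"
        using id fi single by (intro sub_mult_mem)
      then have "f j \<in> Idl\<^bsub>?P\<^esub> (S j)"
        by (simp add: r_def single_uminus)
      then show False using f[of j] by (simp add: minimal_def)
    qed
    ultimately have r: "r \<in> J - Idl\<^bsub>?P\<^esub> (S j)" by blast
    then have "r \<noteq> 0" using nonzero S by blast
    then have "lead_monomial r < lead_monomial (f j)"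
      using c lead_monomial_in_keys[of r] by (simp add: r_def)
    then show False
      using f[of j] r by (simp add: minimal_def)
  qed
qed

section \<open>Passage to quotients\<close>

lemma carrier_FactRing: "carrier (R Quot I) = (\<lambda>x. I +>\<^bsub>R\<^esub> x) ` carrier R"
  by (auto simp: FactRing_def A_RCOSETS_def')

text \<open>The preimage \<open>L\<close> of \<open>J\<close> has finitely many generators, and
  their cosets generate \<open>J\<close>: the elements whose coset lies in the ideal generated by
  these cosets form an ideal of \<open>R\<close> containing \<open>S\<close>, hence all of
  \<open>L\<close>.\<close>

lemma (in ideal) noetherian_quotient:
  assumes "noetherian_ring R"
  shows "noetherian_ring (R Quot I)"
proof -
  interpret Q: ring "R Quot I" by (rule quotient_is_ring)
  interpret h: ring_hom_ring R "R Quot I" "(+>) I" by (rule rcos_ring_hom_ring)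
  show ?thesis
  proof (rule Q.noetherian_ringI)
    fix J assume J: "ideal J (R Quot I)"
    define L where "L = {r \<in> carrier R. I +> r \<in> J}"
    have L: "ideal L R"
      unfolding L_def by (rule h.ideal_vimage[OF J])
    then obtain S where S: "S \<subseteq> carrier R" "finite S" "L = Idl S"
      using noetherian_ring.finetely_gen[OF assms] by blast
    let ?B = "(+>) I ` S"
    have B: "?B \<subseteq> carrier (R Quot I)"
      using S h.hom_closed by blast
    have "?B \<subseteq> J"
      using S genideal_self[OF S(1)] by (auto simp: L_def)
    then have "Idl\<^bsub>R Quot I\<^esub> ?B \<subseteq> J"
      by (rule Q.genideal_minimal[OF J])
    moreover have "J \<subseteq> Idl\<^bsub>R Quot I\<^esub> ?B"
    proof
      fix y assume y: "y \<in> J"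
      then have "y \<in> carrier (R Quot I)"
        using additive_subgroup.a_subset[OF ideal.axioms(1)[OF J]] by blast
      then obtain x where x: "x \<in> carrier R" "y = I +> x"
        using carrier_FactRing[of R I] by auto
      have "Idl S \<subseteq> {r \<in> carrier R. I +> r \<in> Idl\<^bsub>R Quot I\<^esub> ?B}"
        using S(1) Q.genideal_self[OF B]
        by (intro genideal_minimal h.ideal_vimage Q.genideal_ideal B) auto
      moreover have "x \<in> Idl S"
        using x y S(3) by (auto simp: L_def)
      ultimately show "y \<in> Idl\<^bsub>R Quot I\<^esub> ?B"
        using x by blast
    qed
    ultimately show "\<exists>B\<subseteq>carrier (R Quot I). finite B \<and> J = Idl\<^bsub>R Quot I\<^esub> B"
      using B S(2) by blast
  qed
qed

text \<open>Turns \<open>update_induct\<close>, which extends a finitely supported function at a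
  fresh key, into induction on sums. It is applied to exponents, where sums are products of
  monomials, and to polynomials, where they are sums of terms.\<close>

lemma update_eq_add_single:
  fixes f :: "'a \<Rightarrow>\<^sub>0 'b::monoid_add"
  assumes "a \<notin> Poly_Mapping.keys f"
  shows "Poly_Mapping.update a b f = f + Poly_Mapping.single a b"
  using assms
  by (intro poly_mapping_eqI) (auto simp: lookup_update lookup_add lookup_single in_keys_iff)

lemma mpolys_generated:
  fixes T :: "(('v \<Rightarrow>\<^sub>0 nat) \<Rightarrow>\<^sub>0 'k::field) set"
  assumes const: "\<And>c. Poly_Mapping.single 0 c \<in> T"
    and var: "\<And>v. v \<in> V \<Longrightarrow> Poly_Mapping.single (Poly_Mapping.single v 1) 1 \<in> T"
    and add: "\<And>p q. p \<in> T \<Longrightarrow> q \<in> T \<Longrightarrow> p + q \<in> T"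
    and mult: "\<And>p q. p \<in> T \<Longrightarrow> q \<in> T \<Longrightarrow> p * q \<in> T"
  shows "mpolys V \<subseteq> T"
proof
  have var_power: "Poly_Mapping.single (Poly_Mapping.single v e) 1 \<in> T" if v: "v \<in> V" for v e
  proof (induction e)
    case (Suc e)
    have "Poly_Mapping.single (Poly_Mapping.single v (Suc e)) (1::'k)
        = Poly_Mapping.single (Poly_Mapping.single v 1) 1 * Poly_Mapping.single (Poly_Mapping.single v e) 1"
      by (simp add: mult_single flip: single_add)
    then show ?case using mult[OF var[OF v] Suc] by simp
  qed (use const[of 1] in simp)
  have monomial: "Poly_Mapping.keys m \<subseteq> V \<longrightarrow> (\<forall>c. Poly_Mapping.single m c \<in> T)" for m
  proof (induction m rule: update_induct)
    case (update m v e)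
    show ?case
    proof (intro impI allI)
      fix c :: 'k assume "Poly_Mapping.keys (Poly_Mapping.update v e m) \<subseteq> V"
      with update have m: "Poly_Mapping.keys m \<subseteq> V" "v \<in> V" by (auto simp: keys_update)
      have "Poly_Mapping.single (Poly_Mapping.update v e m) c
          = Poly_Mapping.single m c * Poly_Mapping.single (Poly_Mapping.single v e) 1"
        using update(1) by (simp add: mult_single update_eq_add_single)
      then show "Poly_Mapping.single (Poly_Mapping.update v e m) c \<in> T"
        using mult[OF _ var_power[OF m(2)]] update.IH m by simp
    qed
  qed (use const in simp)
  fix p :: "('v \<Rightarrow>\<^sub>0 nat) \<Rightarrow>\<^sub>0 'k" assume "p \<in> mpolys V"
  then show "p \<in> T"
  proof (induction p rule: update_induct)
    case const
    then show ?case using assms(1)[of 0] by simp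
  next
    case (update p m c)
    then have "p \<in> mpolys V" "Poly_Mapping.keys m \<subseteq> V"
      by (auto simp: mpolys_def keys_update)
    then show ?case
      using update add monomial by (simp add: update_eq_add_single)
  qed
qed

lemma generated_algebra_quotient:
  fixes I :: "((nat \<Rightarrow>\<^sub>0 nat) \<Rightarrow>\<^sub>0 'k::field) set"
  assumes "ideal I (mpoly_ring n)"
  shows "generated_algebra (mpoly_ring n Quot I) (quot_scalar n I)
    ((\<lambda>v. I +>\<^bsub>mpoly_ring n\<^esub> Poly_Mapping.single (Poly_Mapping.single v 1) 1) ` {1..n})"
proof -
  interpret I: ideal I "mpoly_ring n" by (rule assms)
  interpret h: ring_hom_ring "mpoly_ring n" "mpoly_ring n Quot I" "(+>\<^bsub>mpoly_ring n\<^esub>) I"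
    by (rule I.rcos_ring_hom_ring)
  interpret A: cring "mpoly_ring n Quot I"
    by (rule I.quotient_is_cring[OF cring_mpoly_ring])
  have const: "Poly_Mapping.single 0 c \<in> carrier (mpoly_ring n)" for c :: 'k
    by (simp add: mpoly_ring_simps single_in_mpolys)
  have var: "Poly_Mapping.single (Poly_Mapping.single v 1) 1 \<in> carrier (mpoly_ring n :: (_ \<Rightarrow>\<^sub>0 'k) ring)"
    if "v \<in> {1..n}" for v
    using that by (simp add: mpoly_ring_simps single_in_mpolys)
  show ?thesis
  proof
    show "quot_scalar n I c \<in> carrier (mpoly_ring n Quot I)" for c
      unfolding quot_scalar_def by (rule h.hom_closed[OF const])
    show "(\<lambda>v. I +>\<^bsub>mpoly_ring n\<^esub> Poly_Mapping.single (Poly_Mapping.single v 1) 1) ` {1..n}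
        \<subseteq> carrier (mpoly_ring n Quot I)"
      using h.hom_closed[OF var] by blast
    fix T
    assume T: "range (quot_scalar n I) \<subseteq> T"
        "(\<lambda>v. I +>\<^bsub>mpoly_ring n\<^esub> Poly_Mapping.single (Poly_Mapping.single v 1) 1) ` {1..n} \<subseteq> T"
      and add: "\<And>a b. a \<in> T \<Longrightarrow> b \<in> T \<Longrightarrow> a \<oplus>\<^bsub>mpoly_ring n Quot I\<^esub> b \<in> T"
      and mult: "\<And>a b. a \<in> T \<Longrightarrow> b \<in> T \<Longrightarrow> a \<otimes>\<^bsub>mpoly_ring n Quot I\<^esub> b \<in> T"
    \<comment> \<open>The preimage of \<open>T\<close> under the quotient map inherits the closure
      properties, which reduces generation of the quotient to that of the polynomial ring.\<close>
    have "mpolys {1..n} \<subseteq> {p \<in> carrier (mpoly_ring n). I +>\<^bsub>mpoly_ring n\<^esub> p \<in> T}"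
    proof (rule mpolys_generated)
      fix p q
      assume p: "p \<in> {p \<in> carrier (mpoly_ring n). I +>\<^bsub>mpoly_ring n\<^esub> p \<in> T}"
        and q: "q \<in> {p \<in> carrier (mpoly_ring n). I +>\<^bsub>mpoly_ring n\<^esub> p \<in> T}"
      show "p + q \<in> {p \<in> carrier (mpoly_ring n). I +>\<^bsub>mpoly_ring n\<^esub> p \<in> T}"
        using p q add h.hom_add[of p q] mpolys_add[of p _ q] by (simp add: mpoly_ring_simps)
      show "p * q \<in> {p \<in> carrier (mpoly_ring n). I +>\<^bsub>mpoly_ring n\<^esub> p \<in> T}"
        using p q mult h.hom_mult[of p q] mpolys_mult[of p _ q] by (simp add: mpoly_ring_simps)
    next
      show "Poly_Mapping.single 0 c \<in> {p \<in> carrier (mpoly_ring n). I +>\<^bsub>mpoly_ring n\<^esub> p \<in> T}" for c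
        using const[of c] T(1) by (auto simp: quot_scalar_def)
      show "Poly_Mapping.single (Poly_Mapping.single v 1) 1
          \<in> {p \<in> carrier (mpoly_ring n). I +>\<^bsub>mpoly_ring n\<^esub> p \<in> T}" if "v \<in> {1..n}" for v
        using var[OF that] T(2) that by auto
    qed
    then have "I +>\<^bsub>mpoly_ring n\<^esub> p \<in> T" if "p \<in> carrier (mpoly_ring n)" for p
      using that unfolding mpoly_ring_simps(1) by blast
    then show "carrier (mpoly_ring n Quot I) \<subseteq> T"
      using carrier_FactRing[of "mpoly_ring n" I] by auto
  qed simp
qed

theorem theorem1p5:
  fixes n i :: nat and I :: "((nat \<Rightarrow>\<^sub>0 nat) \<Rightarrow>\<^sub>0 'k::field_char_0) set"
  assumes "primeideal I (mpoly_ring n)" and "\<not> maximalideal I (mpoly_ring n)"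
  defines "A \<equiv> mpoly_ring n Quot I" and "\<sigma> \<equiv> quot_scalar n I"
  shows "fin_gen_module A ((diff_ops \<sigma> A)\<lparr>carrier := diff_ops_le \<sigma> A i\<rparr>)"
proof -
  have I: "ideal I (mpoly_ring n)"
    using assms(1) by (rule primeideal.axioms(1))
  show ?thesis
    unfolding A_def \<sigma>_def
    using generated_algebra.fin_gen_diff_ops_le[OF generated_algebra_quotient[OF I]]
      ideal.noetherian_quotient[OF I noetherian_mpoly_ring] by blast
qed

end
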